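(* The satisfiability problem for $\exists^*\forall^*\mathsf{SL}(\mathsf{LIA})_{\mathsf{Int},\mathsf{Int}}$ is undecidable: there is no algorithm which, given a sentence $\exists x_1\ldots\exists x_m\forall y_1\ldots\forall y_n ~.~\varphi$ with $\varphi$ a quantifier-free $\mathsf{SL}(\mathsf{LIA})_{\mathsf{Int},\mathsf{Int}}$ formula, decides whether some heap $h$ (together with the standard model of $\mathsf{LIA}$) satisfies it.
   Context: $\mathsf{LIA}$ is linear integer arithmetic: sort $\mathsf{Int}$ interpreted as the integers, with $\geq$, $+$, constants $0,1$ interpreted as usual. $\mathsf{SL}(\mathsf{LIA})_{\mathsf{Int},\mathsf{Int}}$ is separation logic in which both locations and data are of sort $\mathsf{Int}$: formulas are generated by $\varphi ::= \phi \mid \mathsf{emp} \mid t \mapsto u \mid \varphi_1 * \varphi_2 \mid \varphi_1 \mathrel{-\!\!*} \varphi_2 \mid \neg\varphi_1 \mid \varphi_1 \wedge \varphi_2 \mid \exists x ~.~ \varphi_1$, where $\phi$ is a $\mathsf{LIA}$ formula and $t,u$ are $\mathsf{LIA}$ terms; $\forall x.\varphi$ abbreviates $\neg\exists x.\neg\varphi$; there is a designated constant $\mathsf{nil}$ of sort $\mathsf{Int}$. A heap is a finite partial function $h$ from integers to integers. Semantics: $\mathcal{I},h \models \phi$ iff $\mathcal{I} \models \phi$ for $\mathsf{LIA}$ formulas $\phi$; $\mathcal{I},h\models \mathsf{emp}$ iff $h=\emptyset$; $\mathcal{I},h \models t\mapsto u$ iff $h=\{(t^\mathcal{I},u^\mathcal{I})\}$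 and $t^\mathcal{I}\neq \mathsf{nil}^\mathcal{I}$; $\mathcal{I},h\models \varphi_1*\varphi_2$ iff $h = h_1 \uplus h_2$ (disjoint domains) with $\mathcal{I},h_i\models\varphi_i$; $\mathcal{I},h\models \varphi_1\mathrel{-\!\!*}\varphi_2$ iff for every heap $h'$ with domain disjoint from $\mathrm{dom}(h)$ and $\mathcal{I},h'\models\varphi_1$, $\mathcal{I},h'\uplus h\models\varphi_2$; $\mathcal{I},h\models\exists x.\varphi$ iff $\mathcal{I}[x\leftarrow s],h\models\varphi$ for some integer $s$; Boolean connectives are classical. $\exists^*\forall^*\mathsf{SL}(\mathsf{LIA})_{\mathsf{Int},\mathsf{Int}}$ consists of sentences with quantifier prefix $\exists^*\forall^*$ and quantifier-free matrix. *)

theory Defs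
  imports Main "HOL-Library.Nat_Bijection"
begin

datatype lterm = TVar nat | TZero | TOne | TNil | TAdd lterm lterm

text \<open>SL(LIA) formulas. LIA atoms are t >= u; Boolean structure of LIA formulas
  is expressed by the (semantically identical) SL connectives.\<close>
datatype slform =
    FGe lterm lterm
  | FEmp
  | FPt lterm lterm
  | FStar slform slform
  | FWand slform slform
  | FNot slform
  | FAnd slform slform
  | FEx nat slform

definition FAll :: "nat \<Rightarrow> slform \<Rightarrow> slform" where
  "FAll x \<phi> = FNot (FEx x (FNot \<phi>))"

type_synonym heap = "int \<Rightarrow> int option"

fun tval :: "int \<Rightarrow> (nat \<Rightarrow> int) \<Rightarrow> lterm \<Rightarrow> int" where
  "tval nl e (TVar x) = e x"
| "tval nl e TZero = 0"
| "tval nl e TOne = 1"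
| "tval nl e TNil = nl"
| "tval nl e (TAdd a b) = tval nl e a + tval nl e b"

fun holds :: "int \<Rightarrow> (nat \<Rightarrow> int) \<Rightarrow> heap \<Rightarrow> slform \<Rightarrow> bool" where
  "holds nl e h (FGe a b) = (tval nl e a \<ge> tval nl e b)"
| "holds nl e h FEmp = (h = Map.empty)"
| "holds nl e h (FPt a b) = (h = [tval nl e a \<mapsto> tval nl e b] \<and> tval nl e a \<noteq> nl)"
| "holds nl e h (FStar \<phi> \<psi>) =
     (\<exists>h1 h2. dom h1 \<inter> dom h2 = {} \<and> h = h1 ++ h2 \<and> holds nl e h1 \<phi> \<and> holds nl e h2 \<psi>)"
| "holds nl e h (FWand \<phi> \<psi>) =
     (\<forall>h'. finite (dom h') \<longrightarrow> dom h' \<inter> dom h = {} \<longrightarrow> holds nl e h' \<phi> \<longrightarrow> holds nl e (h ++ h') \<psi>)"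
| "holds nl e h (FNot \<phi>) = (\<not> holds nl e h \<phi>)"
| "holds nl e h (FAnd \<phi> \<psi>) = (holds nl e h \<phi> \<and> holds nl e h \<psi>)"
| "holds nl e h (FEx x \<phi>) = (\<exists>s. holds nl (e(x := s)) h \<phi>)"

definition sl_sat :: "slform \<Rightarrow> bool" where
  "sl_sat \<phi> = (\<exists>nl e h. finite (dom h) \<and> holds nl e h \<phi>)"

fun tvars :: "lterm \<Rightarrow> nat set" where
  "tvars (TVar x) = {x}"
| "tvars TZero = {}"
| "tvars TOne = {}"
| "tvars TNil = {}"
| "tvars (TAdd a b) = tvars a \<union> tvars b"

fun fvars :: "slform \<Rightarrow> nat set" where
  "fvars (FGe a b) = tvars a \<union> tvars b"
| "fvars FEmp = {}"
| "fvars (FPt a b) = tvars a \<union> tvars b"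
| "fvars (FStar \<phi> \<psi>) = fvars \<phi> \<union> fvars \<psi>"
| "fvars (FWand \<phi> \<psi>) = fvars \<phi> \<union> fvars \<psi>"
| "fvars (FNot \<phi>) = fvars \<phi>"
| "fvars (FAnd \<phi> \<psi>) = fvars \<phi> \<union> fvars \<psi>"
| "fvars (FEx x \<phi>) = fvars \<phi> - {x}"

fun qfree :: "slform \<Rightarrow> bool" where
  "qfree (FStar \<phi> \<psi>) = (qfree \<phi> \<and> qfree \<psi>)"
| "qfree (FWand \<phi> \<psi>) = (qfree \<phi> \<and> qfree \<psi>)"
| "qfree (FNot \<phi>) = qfree \<phi>"
| "qfree (FAnd \<phi> \<psi>) = (qfree \<phi> \<and> qfree \<psi>)"
| "qfree (FEx x \<phi>) = False"
| "qfree _ = True"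

definition in_EA_fragment :: "slform \<Rightarrow> bool" where
  "in_EA_fragment \<phi> =
     (\<exists>xs ys \<psi>. qfree \<psi> \<and> \<phi> = foldr FEx xs (foldr FAll ys \<psi>) \<and> fvars \<phi> = {})"

fun enc_term :: "lterm \<Rightarrow> nat" where
  "enc_term (TVar x) = prod_encode (0, x)"
| "enc_term TZero = prod_encode (1, 0)"
| "enc_term TOne = prod_encode (2, 0)"
| "enc_term TNil = prod_encode (3, 0)"
| "enc_term (TAdd a b) = prod_encode (4, prod_encode (enc_term a, enc_term b))"

fun enc_form :: "slform \<Rightarrow> nat" where
  "enc_form (FGe a b) = prod_encode (0, prod_encode (enc_term a, enc_term b))"
| "enc_form FEmp = prod_encode (1, 0)"
| "enc_form (FPt a b) = prod_encode (2, prod_encode (enc_term a, enc_term b))"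
| "enc_form (FStar \<phi> \<psi>) = prod_encode (3, prod_encode (enc_form \<phi>, enc_form \<psi>))"
| "enc_form (FWand \<phi> \<psi>) = prod_encode (4, prod_encode (enc_form \<phi>, enc_form \<psi>))"
| "enc_form (FNot \<phi>) = prod_encode (5, enc_form \<phi>)"
| "enc_form (FAnd \<phi> \<psi>) = prod_encode (6, prod_encode (enc_form \<phi>, enc_form \<psi>))"
| "enc_form (FEx x \<phi>) = prod_encode (7, prod_encode (x, enc_form \<phi>))"

text \<open>Total (general) recursive functions of a given arity n, as functions on
  argument lists (only their values on lists of length n are meaningful).
  Minimisation is applied only to functions that always have a zero, so
  every function in the class is total; the class is exactly the total
  computable functions.\<close>
inductive recfn :: "nat \<Rightarrow> (nat list \<Rightarrow> nat) \<Rightarrow> bool" where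
  r_zero: "recfn n (\<lambda>_. 0)"
| r_succ: "recfn 1 (\<lambda>xs. Suc (hd xs))"
| r_proj: "i < n \<Longrightarrow> recfn n (\<lambda>xs. xs ! i)"
| r_comp: "recfn m f \<Longrightarrow> length gs = m \<Longrightarrow> (\<forall>g\<in>set gs. recfn n g) \<Longrightarrow>
           recfn n (\<lambda>xs. f (map (\<lambda>g. g xs) gs))"
| r_prim: "recfn n f \<Longrightarrow> recfn (Suc (Suc n)) g \<Longrightarrow>
           recfn (Suc n) (\<lambda>xs. rec_nat (f (tl xs)) (\<lambda>k r. g (k # r # tl xs)) (hd xs))"
| r_mu: "recfn (Suc n) f \<Longrightarrow> (\<forall>xs. length xs = n \<longrightarrow> (\<exists>y. f (y # xs) = 0)) \<Longrightarrow>
           recfn n (\<lambda>xs. LEAST y. f (y # xs) = 0)"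

end

theory Submission
  imports Defs
begin

text \<open>A heap is a finite table of integers, so quantifier-free clauses over a heap, universally
  quantified, can force it to tabulate a given function. With triangular numbers in a separate
  residue class of addresses, Cantor pairing becomes expressible by addition, and composition,
  primitive recursion and minimisation become local conditions on tables. Hence every total recursive
  \<open>g\<close> has clauses \<open>\<phi>\<close> such that ``\<open>\<phi>\<close> holds and the table contains \<open>g n = 0\<close>'' is satisfiable iff
  \<open>g n = 0\<close>. A decision procedure \<open>f\<close> is refuted by diagonalisation: let \<open>g p\<close> vanish iff \<open>f\<close> rejects
  this sentence for the clauses with code \<open>p\<close> and \<open>n = p\<close>, and take for \<open>p\<close> the code of the clauses
  of \<open>g\<close>.\<close>

section \<open>Clauses over heaps\<close>

text \<open>Without separating connectives, satisfaction reads single cells only, so a table can be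
  moved to other addresses by rewriting terms.\<close>

datatype tform =
    Ge lterm lterm
  | Eq lterm lterm
  | Sel lterm lterm
  | Def lterm
  | Imp tform tform
  | Conj tform tform

fun tsat :: "int \<Rightarrow> (nat \<Rightarrow> int) \<Rightarrow> heap \<Rightarrow> tform \<Rightarrow> bool" where
  "tsat nl e h (Ge a b) = (tval nl e a \<ge> tval nl e b)"
| "tsat nl e h (Eq a b) = (tval nl e a = tval nl e b)"
| "tsat nl e h (Sel a b) = (h (tval nl e a) = Some (tval nl e b))"
| "tsat nl e h (Def a) = (h (tval nl e a) \<noteq> None)"
| "tsat nl e h (Imp \<phi> \<psi>) = (tsat nl e h \<phi> \<longrightarrow> tsat nl e h \<psi>)"
| "tsat nl e h (Conj \<phi> \<psi>) = (tsat nl e h \<phi> \<and> tsat nl e h \<psi>)"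

fun tfv :: "tform \<Rightarrow> nat set" where
  "tfv (Ge a b) = tvars a \<union> tvars b"
| "tfv (Eq a b) = tvars a \<union> tvars b"
| "tfv (Sel a b) = tvars a \<union> tvars b"
| "tfv (Def a) = tvars a"
| "tfv (Imp \<phi> \<psi>) = tfv \<phi> \<union> tfv \<psi>"
| "tfv (Conj \<phi> \<psi>) = tfv \<phi> \<union> tfv \<psi>"

text \<open>The trivially true conjunct absorbs the rest of the heap.\<close>

definition FSel :: "lterm \<Rightarrow> lterm \<Rightarrow> slform" where
  "FSel a b = FStar (FPt a b) (FGe TZero TZero)"

text \<open>The wand \<open>a \<mapsto> 0 -* false\<close> says that no cell at \<open>a\<close> can be added, which holds if \<open>a\<close> is
  allocated, but also if \<open>a = nil\<close>. A heap may also bind \<open>nil\<close>, which no points-to can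
  see; hence the update \<open>h(nl := None)\<close> in the correctness lemmas.\<close>
fun to_sl :: "tform \<Rightarrow> slform" where
  "to_sl (Ge a b) = FGe a b"
| "to_sl (Eq a b) = FAnd (FGe a b) (FGe b a)"
| "to_sl (Sel a b) = FSel a b"
| "to_sl (Def a) = FAnd (FWand (FPt a TZero) (FGe TZero TOne)) (FNot (FAnd (FGe a TNil) (FGe TNil a)))"
| "to_sl (Imp \<phi> \<psi>) = FNot (FAnd (to_sl \<phi>) (FNot (to_sl \<psi>)))"
| "to_sl (Conj \<phi> \<psi>) = FAnd (to_sl \<phi>) (to_sl \<psi>)"

lemma qfree_to_sl: "qfree (to_sl \<phi>)"
  by (induction \<phi>) (auto simp: FSel_def)

lemma fvars_to_sl: "fvars (to_sl \<phi>) = tfv \<phi>"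
  by (induction \<phi>) (auto simp: FSel_def)

lemma holds_FSel:
  "holds nl e h (FSel a b) \<longleftrightarrow> (h(nl := None)) (tval nl e a) = Some (tval nl e b)"
proof
  assume "holds nl e h (FSel a b)"
  then obtain h2 where "tval nl e a \<notin> dom h2" "h = [tval nl e a \<mapsto> tval nl e b] ++ h2"
    "tval nl e a \<noteq> nl"
    by (auto simp: FSel_def)
  then show "(h(nl := None)) (tval nl e a) = Some (tval nl e b)"
    by (auto simp: map_add_def split: option.splits)
next
  assume *: "(h(nl := None)) (tval nl e a) = Some (tval nl e b)"
  let ?h1 = "[tval nl e a \<mapsto> tval nl e b]" and ?h2 = "h(tval nl e a := None)"
  have "h = ?h1 ++ ?h2" "dom ?h1 \<inter> dom ?h2 = {}"
    using * by (auto simp: map_add_def fun_eq_iff split: option.splits if_splits)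
  moreover have "holds nl e ?h1 (FPt a b)" "holds nl e ?h2 (FGe TZero TZero)"
    using * by (auto split: if_splits)
  ultimately show "holds nl e h (FSel a b)"
    unfolding FSel_def holds.simps(4) by blast
qed

lemma holds_to_sl: "holds nl e h (to_sl \<phi>) \<longleftrightarrow> tsat nl e (h(nl := None)) \<phi>"
proof (induction \<phi>)
  case (Def a)
  have "holds nl e h (FWand (FPt a TZero) (FGe TZero TOne)) \<longleftrightarrow>
      tval nl e a = nl \<or> h (tval nl e a) \<noteq> None"
    by (auto simp: dom_def)
  then show ?case by auto
qed (auto simp: holds_FSel)

lemma tval_cong: "(\<And>x. x \<in> tvars t \<Longrightarrow> e x = e' x) \<Longrightarrow> tval nl e t = tval nl e' t"
  by (induction t) auto

lemma tsat_cong: "(\<And>x. x \<in> tfv \<phi> \<Longrightarrow> e x = e' x) \<Longrightarrow> tsat nl e h \<phi> = tsat nl e' h \<phi>"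
  by (induction \<phi>) (auto simp: tval_cong[of _ e e'])

lemma holds_FAll: "holds nl e h (FAll x \<phi>) \<longleftrightarrow> (\<forall>s. holds nl (e(x := s)) h \<phi>)"
  by (simp add: FAll_def)

lemma holds_foldr_FAll:
  "holds nl e h (foldr FAll ys \<phi>) \<longleftrightarrow> (\<forall>e'. (\<forall>x. x \<notin> set ys \<longrightarrow> e' x = e x) \<longrightarrow> holds nl e' h \<phi>)"
proof (induction ys arbitrary: e)
  case Nil
  have "e' = e" if "\<forall>x. e' x = e x" for e' :: "nat \<Rightarrow> int" using that by auto
  then show ?case by auto
next
  case (Cons y ys)
  have "(\<exists>s. \<forall>x. x \<notin> set ys \<longrightarrow> e' x = (e(y := s)) x) \<longleftrightarrow> (\<forall>x. x \<notin> set (y # ys) \<longrightarrow> e' x = e x)"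
    for e' :: "nat \<Rightarrow> int"
    by (rule iffI, force, rule exI[of _ "e' y"]) auto
  note * = this
  have "holds nl e h (foldr FAll (y # ys) \<phi>) \<longleftrightarrow>
      (\<forall>s e'. (\<forall>x. x \<notin> set ys \<longrightarrow> e' x = (e(y := s)) x) \<longrightarrow> holds nl e' h \<phi>)"
    by (simp add: holds_FAll Cons)
  also have "\<dots> \<longleftrightarrow> (\<forall>e'. (\<exists>s. \<forall>x. x \<notin> set ys \<longrightarrow> e' x = (e(y := s)) x) \<longrightarrow> holds nl e' h \<phi>)"
    by blast
  finally show ?case unfolding * .
qed

lemma fvars_foldr_FAll: "fvars (foldr FAll ys \<phi>) = fvars \<phi> - set ys"
  by (induction ys) (auto simp: FAll_def)

abbreviation plus_t (infixl "\<oplus>" 65) where "a \<oplus> b \<equiv> TAdd a b"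
abbreviation V where "V \<equiv> TVar"

section \<open>Specifying functions by tables\<close>

text \<open>Views nest: a residue class modulo 4 is again a full heap, so each auxiliary table has
  room for auxiliary tables of its own.\<close>

definition sect :: "int \<Rightarrow> heap \<Rightarrow> heap" where
  "sect i h = (\<lambda>a. h (4 * a + i))"

fun numt :: "nat \<Rightarrow> lterm" where
  "numt 0 = TZero"
| "numt (Suc n) = TOne \<oplus> numt n"

lemma tval_numt [simp]: "tval nl e (numt n) = int n"
  by (induction n) auto

lemma tvars_numt [simp]: "tvars (numt n) = {}"
  by (induction n) auto

definition quad :: "nat \<Rightarrow> lterm \<Rightarrow> lterm" where
  "quad i t = t \<oplus> t \<oplus> (t \<oplus> t) \<oplus> numt i"

lemma tval_quad [simp]: "tval nl e (quad i t) = 4 * tval nl e t + int i"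
  by (simp add: quad_def)

lemma tvars_quad [simp]: "tvars (quad i t) = tvars t"
  by (simp add: quad_def)

fun shift :: "nat \<Rightarrow> tform \<Rightarrow> tform" where
  "shift i (Ge a b) = Ge a b"
| "shift i (Eq a b) = Eq a b"
| "shift i (Sel a b) = Sel (quad i a) b"
| "shift i (Def a) = Def (quad i a)"
| "shift i (Imp \<phi> \<psi>) = Imp (shift i \<phi>) (shift i \<psi>)"
| "shift i (Conj \<phi> \<psi>) = Conj (shift i \<phi>) (shift i \<psi>)"

lemma tsat_shift [simp]: "tsat nl e h (shift i \<phi>) = tsat nl e (sect (int i) h) \<phi>"
  by (induction \<phi>) (auto simp: sect_def)

lemma tfv_shift [simp]: "tfv (shift i \<phi>) = tfv \<phi>"
  by (induction \<phi>) auto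

text \<open>Shifts stay folded so that \<open>tsat_shift\<close> turns them into views of the heap
  rather than into address arithmetic.\<close>

declare shift.simps [simp del]

text \<open>A finite heap cannot tabulate all of \<open>f\<close>, so free cells are
  tolerated.\<close>

definition agrees :: "heap \<Rightarrow> (nat \<Rightarrow> nat) \<Rightarrow> bool" where
  "agrees h f \<longleftrightarrow> (\<forall>x v. h (int x) = Some v \<longrightarrow> v = int (f x))"

definition tab :: "(nat \<Rightarrow> nat) \<Rightarrow> nat \<Rightarrow> heap" where
  "tab f N = (\<lambda>z. if 0 \<le> z \<and> z \<le> int N then Some (int (f (nat z))) else None)"

lemma agreesD: "agrees h f \<Longrightarrow> h (int x) = Some v \<Longrightarrow> v = int (f x)"
  by (auto simp: agrees_def)

lemma tab_eq_Some: "tab f N z = Some v \<longleftrightarrow> (\<exists>x\<le>N. z = int x \<and> v = int (f x))"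
  by (auto simp: tab_def intro!: exI[of _ "nat z"])

lemma tab_int: "x \<le> N \<Longrightarrow> tab f N (int x) = Some (int (f x))"
  by (simp add: tab_def)

text \<open>A heap satisfying the clauses holds the value \<open>f x\<close> at address \<open>4 x\<close>; the other residues
  modulo 4 are free for the tables of auxiliary functions.\<close>
definition specifies :: "tform \<Rightarrow> (nat \<Rightarrow> nat) \<Rightarrow> bool" where
  "specifies \<phi> f \<longleftrightarrow> tfv \<phi> \<subseteq> {..<10} \<and>
     (\<forall>nl h. (\<forall>e. tsat nl e h \<phi>) \<longrightarrow> agrees (sect 0 h) f) \<and>
     (\<forall>nl N. \<exists>h. finite (dom h) \<and> dom h \<subseteq> {0..} \<and> (\<forall>x\<le>N. sect 0 h (int x) \<noteq> None) \<and>
        (\<forall>e. tsat nl e h \<phi>))"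

definition rep :: "(nat \<Rightarrow> nat) \<Rightarrow> bool" where
  "rep f \<longleftrightarrow> (\<exists>\<phi>. specifies \<phi> f)"

lemma specifies_tfv: "specifies \<phi> f \<Longrightarrow> tfv \<phi> \<subseteq> {..<10}"
  by (simp add: specifies_def)

lemma specifies_agrees: "specifies \<phi> f \<Longrightarrow> \<forall>e. tsat nl e h \<phi> \<Longrightarrow> agrees (sect 0 h) f"
  by (simp add: specifies_def)

text \<open>\<open>specifies\<close> promises only definedness; the values follow because the same
  heap satisfies the clauses and so agrees with \<open>f\<close>.\<close>

lemma specifies_table:
  assumes "specifies \<phi> f"
  obtains h where "finite (dom h)" "dom h \<subseteq> {0..}"
    "\<forall>x\<le>N. sect 0 h (int x) = Some (int (f x))" "\<forall>e. tsat nl e h \<phi>"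
proof -
  obtain h where h: "finite (dom h)" "dom h \<subseteq> {0..}"
    "\<forall>x\<le>N. sect 0 h (int x) \<noteq> None" "\<forall>e. tsat nl e h \<phi>"
    using assms unfolding specifies_def by meson
  moreover have "\<forall>x\<le>N. sect 0 h (int x) = Some (int (f x))"
    using h(3) specifies_agrees[OF assms h(4)] by (auto simp: agrees_def)
  ultimately show thesis using that by blast
qed

definition merge :: "heap \<Rightarrow> heap \<Rightarrow> heap \<Rightarrow> heap \<Rightarrow> heap" where
  "merge h0 h1 h2 h3 = (\<lambda>z. (if z mod 4 = 0 then h0 else if z mod 4 = 1 then h1
      else if z mod 4 = 2 then h2 else h3) (z div 4))"

lemma sect_merge:
  "sect 0 (merge h0 h1 h2 h3) = h0" "sect 1 (merge h0 h1 h2 h3) = h1"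
  "sect 2 (merge h0 h1 h2 h3) = h2" "sect 3 (merge h0 h1 h2 h3) = h3"
proof -
  have "(4 * a + i) mod 4 = i" "(4 * a + i) div 4 = a" if "i \<in> {0..<4}" for a i :: int
    using that by auto
  then show "sect 0 (merge h0 h1 h2 h3) = h0" "sect 1 (merge h0 h1 h2 h3) = h1"
    "sect 2 (merge h0 h1 h2 h3) = h2" "sect 3 (merge h0 h1 h2 h3) = h3"
    by (auto simp: sect_def merge_def)
qed

lemma dom_merge:
  assumes "finite (dom h0)" "finite (dom h1)" "finite (dom h2)" "finite (dom h3)"
    and "dom h0 \<subseteq> {0..}" "dom h1 \<subseteq> {0..}" "dom h2 \<subseteq> {0..}" "dom h3 \<subseteq> {0..}"
  shows "finite (dom (merge h0 h1 h2 h3))" "dom (merge h0 h1 h2 h3) \<subseteq> {0..}"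
proof -
  let ?D = "dom h0 \<union> dom h1 \<union> dom h2 \<union> dom h3"
  have *: "z div 4 \<in> ?D" if "z \<in> dom (merge h0 h1 h2 h3)" for z
    using that by (auto simp: merge_def split: if_splits)
  have "dom (merge h0 h1 h2 h3) \<subseteq> (\<lambda>(a, i). 4 * a + i) ` (?D \<times> {0..<4})"
  proof
    fix z assume "z \<in> dom (merge h0 h1 h2 h3)"
    then show "z \<in> (\<lambda>(a, i). 4 * a + i) ` (?D \<times> {0..<4})"
      using * by (intro image_eqI[of _ _ "(z div 4, z mod 4)"]) auto
  qed
  moreover have "finite (?D \<times> {0..<4::int})" using assms by blast
  ultimately show "finite (dom (merge h0 h1 h2 h3))"
    by (meson finite_imageI finite_subset)
  have "z \<ge> 0" if "z \<in> dom (merge h0 h1 h2 h3)" for z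
  proof -
    have "z div 4 \<ge> 0" using *[OF that] assms(5-8) by auto
    then show ?thesis by simp
  qed
  then show "dom (merge h0 h1 h2 h3) \<subseteq> {0..}" by auto
qed

abbreviation sub :: "int \<Rightarrow> heap \<Rightarrow> heap" where
  "sub i h \<equiv> sect 0 (sect i h)"

text \<open>The clauses \<open>C\<close> define \<open>F\<close> from \<open>f\<^sub>1\<close>, \<open>f\<^sub>2\<close>, \<open>f\<^sub>3\<close>; \<open>S N\<close> collects the arguments at which the
  auxiliary tables must be defined when \<open>F\<close> is tabulated up to \<open>N\<close>.\<close>
lemma rep_step:
  assumes "rep f1" "rep f2" "rep f3" and C: "tfv C \<subseteq> {..<10}"
    and sound: "\<And>nl h. agrees (sub 1 h) f1 \<Longrightarrow> agrees (sub 2 h) f2 \<Longrightarrow> agrees (sub 3 h) f3 \<Longrightarrow>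
      (\<And>e. tsat nl e h C) \<Longrightarrow> agrees (sect 0 h) F"
    and S: "\<And>N. finite (S N)"
    and complete: "\<And>nl N h e. sect 0 h = tab F N \<Longrightarrow>
      (\<And>x. x \<in> S N \<Longrightarrow> sub 1 h (int x) = Some (int (f1 x))) \<Longrightarrow>
      (\<And>x. x \<in> S N \<Longrightarrow> sub 2 h (int x) = Some (int (f2 x))) \<Longrightarrow>
      (\<And>x. x \<in> S N \<Longrightarrow> sub 3 h (int x) = Some (int (f3 x))) \<Longrightarrow> tsat nl e h C"
  shows "rep F"
proof -
  obtain \<phi>1 \<phi>2 \<phi>3 where 1: "specifies \<phi>1 f1" and 2: "specifies \<phi>2 f2" and 3: "specifies \<phi>3 f3"
    using assms(1-3) by (auto simp: rep_def)
  \<comment> \<open>The clauses of \<open>f1\<close>, \<open>f2\<close>, \<open>f3\<close> are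
    confined to residues 1, 2, 3; residue 0 is left to \<open>C\<close>.\<close>
  define \<Phi> where "\<Phi> = Conj C (Conj (shift 1 \<phi>1) (Conj (shift 2 \<phi>2) (shift 3 \<phi>3)))"
  have "tfv \<Phi> \<subseteq> {..<10}"
    using 1[THEN specifies_tfv] 2[THEN specifies_tfv] 3[THEN specifies_tfv] C by (simp add: \<Phi>_def)
  moreover have "agrees (sect 0 h) F" if "\<forall>e. tsat nl e h \<Phi>" for nl h
    using that by (intro sound[of h nl] specifies_agrees[OF 1, of nl] specifies_agrees[OF 2, of nl]
        specifies_agrees[OF 3, of nl]) (simp_all add: \<Phi>_def)
  moreover have "\<exists>h. finite (dom h) \<and> dom h \<subseteq> {0..} \<and> (\<forall>x\<le>N. sect 0 h (int x) \<noteq> None) \<and>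
      (\<forall>e. tsat nl e h \<Phi>)" for nl N
  proof -
    obtain M where M: "\<forall>x\<in>S N. x \<le> M"
      using S[of N] finite_nat_set_iff_bounded_le by blast
    obtain h1 where h1: "finite (dom h1)" "dom h1 \<subseteq> {0..}"
      "\<forall>x\<le>M. sect 0 h1 (int x) = Some (int (f1 x))" "\<forall>e. tsat nl e h1 \<phi>1"
      by (rule specifies_table[OF 1])
    obtain h2 where h2: "finite (dom h2)" "dom h2 \<subseteq> {0..}"
      "\<forall>x\<le>M. sect 0 h2 (int x) = Some (int (f2 x))" "\<forall>e. tsat nl e h2 \<phi>2"
      by (rule specifies_table[OF 2])
    obtain h3 where h3: "finite (dom h3)" "dom h3 \<subseteq> {0..}"
      "\<forall>x\<le>M. sect 0 h3 (int x) = Some (int (f3 x))" "\<forall>e. tsat nl e h3 \<phi>3"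
      by (rule specifies_table[OF 3])
    define h where "h = merge (tab F N) h1 h2 h3"
    have tab: "dom (tab F N) = {0..int N}" by (auto simp: tab_def split: if_splits)
    note sect = sect_merge[of "tab F N" h1 h2 h3, folded h_def]
    have "tsat nl e h C" for e
      using M h1(3) h2(3) h3(3) by (intro complete[of h N]) (simp_all add: sect)
    then have "\<forall>e. tsat nl e h \<Phi>"
      using h1(4) h2(4) h3(4) by (simp add: \<Phi>_def sect)
    moreover have "finite (dom h)" "dom h \<subseteq> {0..}"
      unfolding h_def by (intro dom_merge h1(1,2) h2(1,2) h3(1,2); simp add: tab)+
    ultimately show ?thesis by (intro exI[of _ h]) (simp add: sect tab_int)
  qed
  ultimately have "specifies \<Phi> F" unfolding specifies_def by blast
  then show ?thesis by (auto simp: rep_def)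
qed

text \<open>\<open>O\<close> reads the table of the function being defined, \<open>S i\<close> the
  main table of the function in slot \<open>i\<close>, that is, \<open>sub i\<close>.\<close>

abbreviation OSel where "OSel a b \<equiv> shift 0 (Sel a b)"
abbreviation ODef where "ODef a \<equiv> shift 0 (Def a)"
abbreviation SSel where "SSel i a b \<equiv> shift i (shift 0 (Sel a b))"
abbreviation SDef where "SDef i a \<equiv> shift i (shift 0 (Def a))"

section \<open>Closure properties\<close>

lemma rep_zero: "rep (\<lambda>_. 0)"
proof -
  let ?C = "Imp (OSel (V 0) (V 1)) (Eq (V 1) TZero)"
  have "agrees (sect 0 h) (\<lambda>_. 0)" if "\<forall>e. tsat nl e h ?C" for nl h
    unfolding agrees_def
  proof (intro allI impI)
    fix x v assume "sect 0 h (int x) = Some v"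
    \<comment> \<open>The list serves as an environment, entry \<open>i\<close> being the value of
      variable \<open>i\<close>; later proofs lengthen it as lookups produce new values.\<close>
    then show "v = int 0" using that[rule_format, of "(!) [int x, v]"] by simp
  qed
  moreover have "\<exists>h. finite (dom h) \<and> dom h \<subseteq> {0..} \<and> (\<forall>x\<le>N. sect 0 h (int x) \<noteq> None) \<and>
      (\<forall>e. tsat nl e h ?C)" for nl N
  proof -
    \<comment> \<open>Up to \<open>4 * N\<close>, so that \<open>4 * x\<close> is allocated for
      every \<open>x <= N\<close>.\<close>
    let ?h = "tab (\<lambda>_. 0) (4 * N)"
    have "dom ?h = {0..int (4 * N)}" by (auto simp: tab_def split: if_splits)
    then show ?thesis by (intro exI[of _ ?h]) (auto simp: tab_def sect_def)
  qed
  ultimately show ?thesis unfolding rep_def specifies_def by (intro exI[of _ ?C]) auto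
qed

lemma rep_add_const: "rep (\<lambda>x. x + c)" (is "rep ?F")
proof (rule rep_step[OF rep_zero rep_zero rep_zero])
  let ?C = "Imp (OSel (V 0) (V 1)) (Eq (V 1) (V 0 \<oplus> numt c))"
  show "tfv ?C \<subseteq> {..<10}" by simp
  show "agrees (sect 0 h) ?F" if "\<And>e. tsat nl e h ?C" for nl h
    unfolding agrees_def
  proof (intro allI impI)
    fix x v assume "sect 0 h (int x) = Some v"
    then show "v = int (?F x)" using that[of "(!) [int x, v]"] by (simp)
  qed
  show "finite ((\<lambda>_. {}) N)" for N :: nat by simp
  show "tsat nl e h ?C" if "sect 0 h = tab ?F N" for nl N h e
    using that by (auto simp: tab_eq_Some)
qed

lemma rep_id: "rep (\<lambda>x. x)"
  using rep_add_const[of 0] by simp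

lemma rep_succ: "rep Suc"
  using rep_add_const[of 1] by simp

text \<open>Later flips the verdict of the decision procedure.\<close>

lemma rep_is_zero: "rep (\<lambda>x. if x = 0 then 1 else 0)" (is "rep ?F")
proof (rule rep_step[OF rep_zero rep_zero rep_zero])
  let ?C = "Imp (OSel (V 0) (V 1)) (Conj (Imp (Eq (V 0) TZero) (Eq (V 1) TOne))
     (Imp (Ge (V 0) TOne) (Eq (V 1) TZero)))"
  show "tfv ?C \<subseteq> {..<10}" by simp
  show "agrees (sect 0 h) ?F" if "\<And>e. tsat nl e h ?C" for nl h
    unfolding agrees_def
  proof (intro allI impI)
    fix x v assume "sect 0 h (int x) = Some v"
    then show "v = int (?F x)" using that[of "(!) [int x, v]"] by (auto)
  qed
  show "finite ((\<lambda>_. {}) N)" for N :: nat by simp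
  show "tsat nl e h ?C" if "sect 0 h = tab ?F N" for nl N h e
    using that by (auto simp: tab_eq_Some)
qed

text \<open>Cell \<open>x + 1\<close> demands cell \<open>x\<close> and fixes the difference, so an
  allocated cell forces all cells below it down to 0. The guard on \<open>V 0\<close> stops the
  descent there.\<close>

lemma rep_triangle: "rep triangle"
proof (rule rep_step[OF rep_zero rep_zero rep_zero])
  let ?C = "Conj (Imp (OSel TZero (V 1)) (Eq (V 1) TZero))
     (Imp (Conj (Ge (V 0) TZero) (OSel (V 0 \<oplus> TOne) (V 1)))
       (Conj (ODef (V 0)) (Imp (OSel (V 0) (V 2)) (Eq (V 1) (V 2 \<oplus> V 0 \<oplus> TOne)))))"
  show "tfv ?C \<subseteq> {..<10}" by simp
  show "agrees (sect 0 h) triangle" if C: "\<And>e. tsat nl e h ?C" for nl h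
  proof -
    have "sect 0 h (int x) = Some v \<Longrightarrow> v = int (triangle x)" for x v
    proof (induction x arbitrary: v)
      case 0
      then show ?case using C[of "(!) [0, v]"] by simp
    next
      case (Suc x)
      then obtain w where w: "sect 0 h (int x) = Some w"
        using C[of "(!) [int x, v]"] by (auto simp: algebra_simps)
      with Suc show ?case
        using C[of "(!) [int x, v, w]"] by (simp add: algebra_simps)
    qed
    then show ?thesis by (simp add: agrees_def)
  qed
  show "finite ((\<lambda>_. {}) N)" for N :: nat by simp
  show "tsat nl e h ?C" if "sect 0 h = tab triangle N" for nl N h e
  proof -
    have "\<exists>k. x = Suc k \<and> e 0 = int k" if "0 \<le> e 0" "e 0 + 1 = int x" for x
      using that by (intro exI[of _ "nat (e 0)"]) auto
    then show ?thesis
      using that by (fastforce simp: tab_eq_Some tab_int)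
  qed
qed

section \<open>Composition and Cantor pairing\<close>

lemma rep_comp:
  assumes "rep f" "rep g"
  shows "rep (\<lambda>x. f (g x))" (is "rep ?F")
proof (rule rep_step[OF rep_zero assms])
  let ?C = "Imp (OSel (V 0) (V 1)) (Conj (SDef 3 (V 0))
    (Imp (SSel 3 (V 0) (V 2)) (SSel 2 (V 2) (V 1))))"
  show "tfv ?C \<subseteq> {..<10}" by simp
  show "agrees (sect 0 h) ?F"
    if C: "\<And>e. tsat nl e h ?C" and f: "agrees (sub 2 h) f" and g: "agrees (sub 3 h) g" for nl h
    unfolding agrees_def
  proof (intro allI impI)
    fix x v assume v: "sect 0 h (int x) = Some v"
    then obtain u where u: "sub 3 h (int x) = Some u"
      using C[of "(!) [int x, v]"] by auto
    then have "sub 2 h u = Some v" using v C[of "(!) [int x, v, u]"] by simp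
    then show "v = int (?F x)" using agreesD[OF g u] agreesD[OF f] by blast
  qed
  \<comment> \<open>The table of \<open>g\<close> is read at \<open>x\<close>, that of
    \<open>f\<close> at \<open>g x\<close>; the union serves both slots.\<close>
  show "finite ({..N} \<union> g ` {..N})" for N :: nat by simp
  show "tsat nl e h ?C" if own: "sect 0 h = tab ?F N"
    and f: "\<And>x. x \<in> {..N} \<union> g ` {..N} \<Longrightarrow> sub 2 h (int x) = Some (int (f x))"
    and g: "\<And>x. x \<in> {..N} \<union> g ` {..N} \<Longrightarrow> sub 3 h (int x) = Some (int (g x))" for nl N h e
  proof -
    have "tsat nl e h ?C" if "x \<le> N" "e 0 = int x" for x
      using that own f[of "g x"] g[of x] by (auto simp add: tab_int)
    then show ?thesis using own by (auto simp: tab_eq_Some)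
  qed
qed

lemma rep_const: "rep (\<lambda>_. c)"
proof (induction c)
  case 0
  show ?case by (rule rep_zero)
next
  case (Suc c)
  show ?case by (rule rep_comp[OF rep_succ Suc])
qed

text \<open>\<open>prod_encode (a, b)\<close> is \<open>triangle (a + b) + a\<close>, so a lookup in
  a triangle table replaces multiplication, absent from linear arithmetic.\<close>

lemma rep_pair:
  assumes "rep f" "rep g"
  shows "rep (\<lambda>x. prod_encode (f x, g x))" (is "rep ?F")
proof (rule rep_step[OF rep_triangle assms])
  let ?C = "Imp (OSel (V 0) (V 1)) (Conj (SDef 2 (V 0)) (Conj (SDef 3 (V 0))
    (Imp (Conj (SSel 2 (V 0) (V 2)) (SSel 3 (V 0) (V 3)))
      (Conj (SDef 1 (V 2 \<oplus> V 3)) (Imp (SSel 1 (V 2 \<oplus> V 3) (V 4)) (Eq (V 1) (V 4 \<oplus> V 2)))))))"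
  show "tfv ?C \<subseteq> {..<10}" by simp
  show "agrees (sect 0 h) ?F"
    if C: "\<And>e. tsat nl e h ?C" and t: "agrees (sub 1 h) triangle"
      and f: "agrees (sub 2 h) f" and g: "agrees (sub 3 h) g" for nl h
    unfolding agrees_def
  proof (intro allI impI)
    fix x v assume v: "sect 0 h (int x) = Some v"
    then obtain a b where "sub 2 h (int x) = Some a" "sub 3 h (int x) = Some b"
      using C[of "(!) [int x, v]"] by auto
    then have ab: "sub 2 h (int x) = Some (int (f x))" "sub 3 h (int x) = Some (int (g x))"
      using agreesD[OF f] agreesD[OF g] by blast+
    then obtain s where s: "sub 1 h (int (f x + g x)) = Some s"
      using v C[of "(!) [int x, v, int (f x), int (g x)]"] by auto
    then show "v = int (?F x)"
      using v ab agreesD[OF t s] C[of "(!) [int x, v, int (f x), int (g x), s]"]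
      by (simp add: prod_encode_def)
  qed
  let ?S = "\<lambda>N. {..N} \<union> (\<lambda>x. f x + g x) ` {..N}"
  show "finite (?S N)" for N :: nat by simp
  show "tsat nl e h ?C" if own: "sect 0 h = tab ?F N"
    and t: "\<And>x. x \<in> ?S N \<Longrightarrow> sub 1 h (int x) = Some (int (triangle x))"
    and f: "\<And>x. x \<in> ?S N \<Longrightarrow> sub 2 h (int x) = Some (int (f x))"
    and g: "\<And>x. x \<in> ?S N \<Longrightarrow> sub 3 h (int x) = Some (int (g x))" for nl N h e
  proof -
    have "tsat nl e h ?C" if "x \<le> N" "e 0 = int x" for x
      using that own f[of x] g[of x] t[of "f x + g x"] by (auto simp: tab_int prod_encode_def)
    then show ?thesis using own by (auto simp: tab_eq_Some)
  qed
qed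

section \<open>Unpairing, minimisation and primitive recursion\<close>

lemma le_triangle: "n \<le> triangle n"
  by (induction n) auto

lemma nonneg_int: "0 \<le> (a::int) \<Longrightarrow> \<exists>n. a = int n"
  using nonneg_int_cases by blast

text \<open>The guard \<open>k + p \<le> x\<close> keeps the required part of the triangle table finite; it loses
  nothing since \<open>x = triangle (k + p) + k \<ge> k + p\<close>.\<close>
lemma rep_decode:
  "rep (\<lambda>x. if b then fst (prod_decode x) else snd (prod_decode x))" (is "rep ?F")
proof (rule rep_step[OF rep_triangle rep_zero rep_zero])
  \<comment> \<open>The components are guessed by universal variables, and the equation admits only
    the pair coded by \<open>V 0\<close>. The choice on \<open>b\<close> covers both projections at
    once.\<close>
  let ?C = "Imp (Conj (OSel (V 0) (V 1)) (Conj (Ge (V 2) TZero) (Conj (Ge (V 3) TZero)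
      (Ge (V 0) (V 2 \<oplus> V 3)))))
    (Conj (SDef 1 (V 2 \<oplus> V 3)) (Imp (Conj (SSel 1 (V 2 \<oplus> V 3) (V 4)) (Eq (V 0) (V 4 \<oplus> V 2)))
      (Eq (V 1) (if b then V 2 else V 3))))"
  show "tfv ?C \<subseteq> {..<10}" by simp
  show "agrees (sect 0 h) ?F"
    if C: "\<And>e. tsat nl e h ?C" and t: "agrees (sub 1 h) triangle" for nl h
    unfolding agrees_def
  proof (intro allI impI)
    fix x v assume v: "sect 0 h (int x) = Some v"
    obtain k p where kp: "prod_decode x = (k, p)" by (cases "prod_decode x")
    then have "x = prod_encode (k, p)" by (metis prod_decode_inverse)
    then have x: "x = triangle (k + p) + k" by (simp add: prod_encode_def)
    then have "k + p \<le> x" using le_triangle[of "k + p"] by simp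
    then obtain s where s: "sub 1 h (int (k + p)) = Some s"
      using v C[of "(!) [int x, v, int k, int p]"] by auto
    then show "v = int (?F x)"
      using v \<open>k + p \<le> x\<close> agreesD[OF t s] C[of "(!) [int x, v, int k, int p, s]"] x
      by (auto simp: kp[unfolded x])
  qed
  show "finite ({..N})" for N :: nat by simp
  show "tsat nl e h ?C" if own: "sect 0 h = tab ?F N"
    and t: "\<And>x. x \<in> {..N} \<Longrightarrow> sub 1 h (int x) = Some (int (triangle x))" for nl N h e
  proof -
    have "tsat nl e h ?C" if "x \<le> N" "e 0 = int x" "k + p \<le> x" "e 2 = int k" "e 3 = int p" for x k p
    proof -
      have "prod_decode x = (k, p)" if "x = triangle (k + p) + k"
        using that prod_encode_inverse[of "(k, p)"] by (simp add: prod_encode_def)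
      moreover have "int x = int (triangle (k + p)) + int k \<longleftrightarrow> x = triangle (k + p) + k"
        by linarith
      ultimately show ?thesis
        using that own t[of "k + p"] by (auto simp: tab_int)
    qed
    moreover have "\<exists>x\<le>N. e 0 = int x" if "sect 0 h (e 0) = Some (e 1)"
      using that own by (auto simp: tab_eq_Some)
    moreover have "k + p \<le> x" if "e 2 = int k" "e 3 = int p" "e 0 = int x" "e 2 + e 3 \<le> e 0" for k p x
      using that by linarith
    ultimately show ?thesis
      using nonneg_int[of "e 2"] nonneg_int[of "e 3"] unfolding tsat.simps tsat_shift tval.simps by auto
  qed
qed

lemma rep_fst: "rep (\<lambda>x. fst (prod_decode x))"
  using rep_decode[of True] by simp

lemma rep_snd: "rep (\<lambda>x. snd (prod_decode x))"
  using rep_decode[of False] by simp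

text \<open>The value \<open>v\<close> at \<open>p\<close> bounds the search: \<open>f\<close> must
  be positive at the codes of \<open>(z, p)\<close> with \<open>z < v\<close> and zero for
  \<open>z = v\<close>. So each entry inspects finitely many cells.\<close>

lemma rep_mu:
  assumes "rep f" and ex: "\<And>p. \<exists>y. f (prod_encode (y, p)) = 0"
  shows "rep (\<lambda>p. LEAST y. f (prod_encode (y, p)) = 0)" (is "rep ?F")
proof (rule rep_step[OF rep_triangle assms(1) rep_zero])
  let ?C = "Imp (OSel (V 0) (V 1)) (Conj (Ge (V 1) TZero)
    (Imp (Conj (Ge (V 2) TZero) (Ge (V 1) (V 2))) (Conj (SDef 1 (V 2 \<oplus> V 0))
      (Imp (SSel 1 (V 2 \<oplus> V 0) (V 3)) (Conj (SDef 2 (V 3 \<oplus> V 2))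
        (Imp (SSel 2 (V 3 \<oplus> V 2) (V 4)) (Conj (Imp (Ge (V 1) (V 2 \<oplus> TOne)) (Ge (V 4) TOne))
           (Imp (Eq (V 1) (V 2)) (Eq (V 4) TZero)))))))))"
  show "tfv ?C \<subseteq> {..<10}" by simp
  show "agrees (sect 0 h) ?F"
    if C: "\<And>e. tsat nl e h ?C" and t: "agrees (sub 1 h) triangle" and f: "agrees (sub 2 h) f" for nl h
    unfolding agrees_def
  proof (intro allI impI)
    fix p v assume v: "sect 0 h (int p) = Some v"
    then have "v \<ge> 0" using C[of "(!) [int p, v]"] by simp
    then obtain y where y: "v = int y" using nonneg_int by blast
    have *: "(z < y \<longrightarrow> f (prod_encode (z, p)) \<noteq> 0) \<and> (z = y \<longrightarrow> f (prod_encode (z, p)) = 0)"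
      if zy: "z \<le> y" for z
    proof -
      obtain s where s: "sub 1 h (int (z + p)) = Some s"
        using v y zy C[of "(!) [int p, v, int z]"] by auto
      note s' = agreesD[OF t s]
      obtain w where w: "sub 2 h (int (prod_encode (z, p))) = Some w"
        using v y s s' zy C[of "(!) [int p, v, int z, s]"] by (auto simp: prod_encode_def)
      then show ?thesis
        using v y s s' zy agreesD[OF f w] C[of "(!) [int p, v, int z, s, w]"]
        by (auto simp: prod_encode_def)
    qed
    have "y = ?F p"
    proof (intro Least_equality[symmetric])
      show "f (prod_encode (y, p)) = 0" using *[of y] by simp
      show "y \<le> z" if "f (prod_encode (z, p)) = 0" for z
        using *[of z] that by (cases "z < y") auto
    qed
    then show "v = int (?F p)" using y by simp
  qed
  let ?S = "\<lambda>N. \<Union>p\<in>{..N}. \<Union>y\<in>{..?F p}. {y + p, prod_encode (y, p)}"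
  show "finite (?S N)" for N :: nat by simp
  show "tsat nl e h ?C" if own: "sect 0 h = tab ?F N"
    and t: "\<And>x. x \<in> ?S N \<Longrightarrow> sub 1 h (int x) = Some (int (triangle x))"
    and f: "\<And>x. x \<in> ?S N \<Longrightarrow> sub 2 h (int x) = Some (int (f x))" for nl N h e
  proof -
    have "tsat nl e h ?C" if *: "p \<le> N" "e 0 = int p" "e 1 = int (?F p)"
      "e 2 = int y" "y \<le> ?F p" for p y
    proof -
      have "y + p \<in> ?S N" "prod_encode (y, p) \<in> ?S N" using * by auto
      moreover have "y < ?F p \<Longrightarrow> f (prod_encode (y, p)) \<noteq> 0" using not_less_Least by blast
      moreover have "f (prod_encode (?F p, p)) = 0" using ex by (rule LeastI_ex)
      ultimately show ?thesis
        using * t[of "y + p"] f[of "prod_encode (y, p)"] by (auto simp: prod_encode_def)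
    qed
    moreover have "\<exists>p\<le>N. e 0 = int p \<and> e 1 = int (?F p)" if "sect 0 h (e 0) = Some (e 1)"
      using that own by (auto simp: tab_eq_Some)
    moreover have "y \<le> z" if "e 2 = int y" "e 1 = int z" "e 2 \<le> e 1" for y z
      using that by linarith
    ultimately show ?thesis
      using nonneg_int[of "e 2"] unfolding tsat.simps tsat_shift tval.simps int_ops(1) by auto
  qed
qed

text \<open>In \<open>?C1\<close>, \<open>V 0\<close> is the code of \<open>(k + 1, p)\<close>, which exceeds \<open>triangle (k + p) + k\<close>, the code of
  \<open>(k, p)\<close>. So the predecessor lies in the same initial segment of the table.\<close>
lemma rep_prim:
  assumes "rep f" "rep g"
  shows "rep (\<lambda>x. case prod_decode x of (k, p) \<Rightarrow>
    rec_nat (f p) (\<lambda>k r. g (prod_encode (k, prod_encode (r, p)))) k)" (is "rep ?F")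
proof (rule rep_step[OF rep_triangle assms])
  \<comment> \<open>The code of \<open>(0, p)\<close> is \<open>triangle p\<close>, so a triangle
    lookup at \<open>V 3\<close> returning \<open>V 0\<close> detects the base case with parameter
    \<open>V 3\<close>.\<close>
  let ?C0 = "Imp (Conj (OSel (V 0) (V 1)) (Conj (Ge (V 3) TZero) (Ge (V 0) (V 3))))
    (Conj (SDef 1 (V 3)) (Imp (SSel 1 (V 3) (V 0)) (SSel 2 (V 3) (V 1))))"
  \<comment> \<open>With \<open>V 2 = k\<close> and \<open>V 3 = p\<close>, \<open>V 4\<close> is
    \<open>triangle (k + p)\<close>, \<open>V 5\<close> the previous value \<open>r\<close>,
    \<open>V 6\<close> is \<open>triangle (r + p)\<close>, and \<open>V 7\<close> the triangle
    number in the code of \<open>(k, (r, p))\<close>. The equation uses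
    \<open>triangle (n + 1) = triangle n + n + 1\<close>.\<close>
  let ?C1 = "Imp (Conj (OSel (V 0) (V 1)) (Conj (Ge (V 2) TZero) (Conj (Ge (V 3) TZero)
      (Ge (V 0) (V 2 \<oplus> V 3)))))
    (Conj (SDef 1 (V 2 \<oplus> V 3))
    (Imp (Conj (SSel 1 (V 2 \<oplus> V 3) (V 4))
      (Eq (V 0) (V 4 \<oplus> (V 2 \<oplus> V 3 \<oplus> TOne) \<oplus> (V 2 \<oplus> TOne))))
    (Conj (ODef (V 4 \<oplus> V 2)) (Imp (OSel (V 4 \<oplus> V 2) (V 5))
    (Conj (SDef 1 (V 5 \<oplus> V 3)) (Imp (SSel 1 (V 5 \<oplus> V 3) (V 6))
    (Conj (SDef 1 (V 2 \<oplus> (V 6 \<oplus> V 5))) (Imp (SSel 1 (V 2 \<oplus> (V 6 \<oplus> V 5)) (V 7))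
      (SSel 3 (V 7 \<oplus> V 2) (V 1))))))))))"
  define F where "F k p = rec_nat (f p) (\<lambda>k r. g (prod_encode (k, prod_encode (r, p)))) k" for k p
  have F0: "F 0 p = f p" for p by (simp add: F_def)
  have FSuc: "F (Suc k) p = g (prod_encode (k, prod_encode (F k p, p)))" for k p
    by (simp add: F_def)
  have F: "?F (prod_encode (k, p)) = F k p" for k p by (simp add: F_def)
  show "tfv (Conj ?C0 ?C1) \<subseteq> {..<10}" by simp
  show "agrees (sect 0 h) ?F"
    if C: "\<And>e. tsat nl e h (Conj ?C0 ?C1)" and t: "agrees (sub 1 h) triangle"
      and f: "agrees (sub 2 h) f" and g: "agrees (sub 3 h) g" for nl h
  proof -
    have C0: "tsat nl e h ?C0" and C1: "tsat nl e h ?C1" for e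
      using C[of e] by (simp_all only: tsat.simps(6))
    have "sect 0 h (int (prod_encode (k, p))) = Some v \<Longrightarrow> v = int (F k p)" for k p v
    proof (induction k arbitrary: v)
      case 0
      define x where "x = prod_encode (0, p)"
      have x: "x = triangle p" "p \<le> x" using le_triangle by (simp_all add: x_def prod_encode_def)
      obtain s where s: "sub 1 h (int p) = Some s"
        using 0 x C0[of "(!) [int x, v, 0, int p]"] by (auto simp flip: x_def)
      then have "sub 2 h (int p) = Some v"
        using 0 x agreesD[OF t s] C0[of "(!) [int x, v, 0, int p]"] by (simp flip: x_def)
      then show ?case using agreesD[OF f] F0 by simp
    next
      case (Suc k)
      define x where "x = prod_encode (Suc k, p)"
      have x: "x = triangle (k + p) + (k + p + 1) + (k + 1)" "k + p \<le> x"
        by (simp_all add: x_def prod_encode_def)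
      have own: "sect 0 h (int x) = Some v" using Suc.prems by (simp add: x_def)
      obtain s where s: "sub 1 h (int (k + p)) = Some s"
        using own x(2) C1[of "(!) [int x, v, int k, int p]"] by auto
      note s' = agreesD[OF t s]
      have xs: "int x = s + (int k + int p + 1) + (int k + 1)" using x(1) s' by simp
      obtain r where r: "sect 0 h (s + int k) = Some r"
        using own x(2) s xs C1[of "(!) [int x, v, int k, int p, s]"] by auto
      have r': "r = int (F k p)"
        using r s' by (intro Suc.IH) (simp add: prod_encode_def)
      obtain s1 where s1: "sub 1 h (int (F k p + p)) = Some s1"
        using own x(2) s xs r r' C1[of "(!) [int x, v, int k, int p, s, r]"] by auto
      note s1' = agreesD[OF t s1]
      have q: "s1 + r = int (prod_encode (F k p, p))" using s1' r' by (simp add: prod_encode_def)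
      obtain s2 where s2: "sub 1 h (int (k + prod_encode (F k p, p))) = Some s2"
        using own x(2) s xs r r' s1 q C1[of "(!) [int x, v, int k, int p, s, r, s1]"] by auto
      note s2' = agreesD[OF t s2]
      have c: "s2 + int k = int (prod_encode (k, prod_encode (F k p, p)))"
        using s2' by (simp add: prod_encode_def del: of_nat_add flip: of_nat_add)
      have "sub 3 h (int (prod_encode (k, prod_encode (F k p, p)))) = Some v"
        using own x(2) s xs r r' s1 q s2 c C1[of "(!) [int x, v, int k, int p, s, r, s1, s2]"] by auto
      then show ?case using agreesD[OF g] FSuc by simp
    qed
    note sound = this
    show ?thesis
      unfolding agrees_def
    proof (intro allI impI)
      fix x v assume v: "sect 0 h (int x) = Some v"
      obtain k p where "prod_decode x = (k, p)" by (cases "prod_decode x")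
      then have x: "x = prod_encode (k, p)" by (metis prod_decode_inverse)
      show "v = int (?F x)" using sound[of k p v] v unfolding x F by blast
    qed
  qed
  \<comment> \<open>The guards bound \<open>k\<close> and \<open>p\<close> by \<open>x <= N\<close>,
    so this square covers all demands.\<close>
  let ?S = "\<lambda>N. \<Union>k\<in>{..N}. \<Union>p\<in>{..N}. {p, k + p, F k p + p, k + prod_encode (F k p, p),
    prod_encode (k, prod_encode (F k p, p))}"
  show "finite (?S N)" for N :: nat by simp
  show "tsat nl e h (Conj ?C0 ?C1)" if own: "sect 0 h = tab ?F N"
    and t: "\<And>x. x \<in> ?S N \<Longrightarrow> sub 1 h (int x) = Some (int (triangle x))"
    and f: "\<And>x. x \<in> ?S N \<Longrightarrow> sub 2 h (int x) = Some (int (f x))"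
    and g: "\<And>x. x \<in> ?S N \<Longrightarrow> sub 3 h (int x) = Some (int (g x))" for nl N h e
  proof -
    have own': "sect 0 h (int (prod_encode (k, p))) = Some (int (F k p))"
      if "prod_encode (k, p) \<le> N" for k p
      using tab_int[OF that, of ?F] own by (simp add: F_def)
    have S: "p \<in> ?S N" "k + p \<in> ?S N" "F k p + p \<in> ?S N" "k + prod_encode (F k p, p) \<in> ?S N"
        "prod_encode (k, prod_encode (F k p, p)) \<in> ?S N" if "k \<le> N" "p \<le> N" for k p
      by (rule UN_I[of k], simp add: that, rule UN_I[of p], simp add: that, simp)+
    have 0: "tsat nl e h ?C0" if *: "x \<le> N" "e 0 = int x" "e 1 = int (?F x)" "e 3 = int p" "p \<le> x" for x p
    proof -
      have "p \<in> ?S N" using S(1)[of 0 p] * by linarith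
      moreover have "?F x = f p" if "x = triangle p"
        using F[of 0 p] that by (simp add: prod_encode_def F0)
      ultimately show ?thesis
        using * t[of p] f[of p] by auto
    qed
    have 1: "tsat nl e h ?C1" if *: "x \<le> N" "e 0 = int x" "e 1 = int (?F x)" "e 2 = int k" "e 3 = int p"
      "k + p \<le> x" for x k p
    proof (cases "x = prod_encode (Suc k, p)")
      case True
      have "k \<le> N" "p \<le> N" using * by simp_all
      note S = S[OF this]
      have le: "prod_encode (k, p) \<le> N" using True * by (simp add: prod_encode_def)
      have "e 1 = int (g (prod_encode (k, prod_encode (F k p, p))))"
        using * True F FSuc by simp
      then show ?thesis
        using *(2,4,5) own'[OF le] t[OF S(2)] t[OF S(3)] t[OF S(4)] g[OF S(5)]
        by (auto simp: prod_encode_def)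
    next
      case False
      \<comment> \<open>A wrong guess fails the code equation, which leaves only the demand for the
        triangle cell at \<open>k + p\<close>.\<close>
      then have "int x \<noteq> int (triangle (k + p)) + (int k + int p + 1) + (int k + 1)"
        by (simp add: prod_encode_def)
      moreover have "k + p \<in> ?S N" using S(2)[of k p] * by linarith
      ultimately show ?thesis using * t[of "k + p"] by auto
    qed
    have own_x: "\<exists>x\<le>N. e 0 = int x \<and> e 1 = int (?F x)" if "sect 0 h (e 0) = Some (e 1)"
      using that unfolding own tab_eq_Some by blast
    have "tsat nl e h ?C0"
    proof (cases "sect 0 h (e 0) = Some (e 1) \<and> 0 \<le> e 3 \<and> e 3 \<le> e 0")
      case True
      then obtain x p where "x \<le> N" "e 0 = int x" "e 1 = int (?F x)" "e 3 = int p"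
        using own_x nonneg_int by blast
      with True show ?thesis by (intro 0[of x p]) auto
    qed auto
    moreover have "tsat nl e h ?C1"
    proof (cases "sect 0 h (e 0) = Some (e 1) \<and> 0 \<le> e 2 \<and> 0 \<le> e 3 \<and> e 2 + e 3 \<le> e 0")
      case True
      then obtain x k p where "x \<le> N" "e 0 = int x" "e 1 = int (?F x)" "e 2 = int k" "e 3 = int p"
        using own_x nonneg_int by blast
      with True show ?thesis by (intro 1[of x k p]) auto
    qed auto
    ultimately show ?thesis by (simp only: tsat.simps(6))
  qed
qed

section \<open>Recursive functions\<close>

text \<open>Injective only for a fixed length: \<open>[]\<close> and \<open>[0]\<close> share the
  code 0. The arity is always known, and head and tail become plain projections.\<close>

fun enc :: "nat list \<Rightarrow> nat" where
  "enc [] = 0"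
| "enc (x # xs) = prod_encode (x, enc xs)"

lemma rep_nth: "\<exists>F. rep F \<and> (\<forall>xs. i < length xs \<longrightarrow> F (enc xs) = xs ! i)"
proof (induction i)
  case 0
  have "fst (prod_decode (enc xs)) = xs ! 0" if "0 < length xs" for xs
    using that by (cases xs) auto
  with rep_fst show ?case by (intro exI[of _ "\<lambda>x. fst (prod_decode x)"]) simp
next
  case (Suc i)
  then obtain F where F: "rep F" "\<And>xs. i < length xs \<Longrightarrow> F (enc xs) = xs ! i" by blast
  have "F (snd (prod_decode (enc xs))) = xs ! Suc i" if "Suc i < length xs" for xs
    using that F(2) by (cases xs) auto
  with rep_comp[OF F(1) rep_snd] show ?case
    by (intro exI[of _ "\<lambda>x. F (snd (prod_decode x))"]) simp
qed

lemma rep_map: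
  assumes "\<forall>g\<in>set gs. \<exists>G. rep G \<and> (\<forall>xs. length xs = n \<longrightarrow> G (enc xs) = g xs)"
  shows "\<exists>H. rep H \<and> (\<forall>xs. length xs = n \<longrightarrow> H (enc xs) = enc (map (\<lambda>g. g xs) gs))"
  using assms
proof (induction gs)
  case Nil
  show ?case using rep_zero by (intro exI[of _ "\<lambda>_. 0"]) simp
next
  case (Cons g gs)
  from Cons.prems obtain G where G: "rep G" "\<forall>xs. length xs = n \<longrightarrow> G (enc xs) = g xs" by auto
  from Cons obtain H where
    H: "rep H" "\<forall>xs. length xs = n \<longrightarrow> H (enc xs) = enc (map (\<lambda>g. g xs) gs)" by auto
  show ?case
    using rep_pair[OF G(1) H(1)] G(2) H(2) by (intro exI[of _ "\<lambda>x. prod_encode (G x, H x)"]) simp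
qed

text \<open>Not every number codes a list of length \<open>n\<close>. The retraction makes the function to be minimised
  have a zero for every parameter, as \<open>rep_mu\<close> demands.\<close>
lemma rep_retract_enc:
  "\<exists>H. rep H \<and> (\<forall>p. \<exists>xs. length xs = n \<and> H p = enc xs) \<and>
     (\<forall>xs. length xs = n \<longrightarrow> H (enc xs) = enc xs)"
proof (induction n)
  case 0
  show ?case using rep_zero by (intro exI[of _ "\<lambda>_. 0"]) simp
next
  case (Suc n)
  then obtain H where H: "rep H" "\<And>p. \<exists>xs. length xs = n \<and> H p = enc xs"
    "\<And>xs. length xs = n \<Longrightarrow> H (enc xs) = enc xs" by blast
  let ?H = "\<lambda>p. prod_encode (fst (prod_decode p), H (snd (prod_decode p)))"
  have "rep ?H" by (rule rep_pair[OF rep_fst rep_comp[OF H(1) rep_snd]])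
  moreover have "\<exists>xs. length xs = Suc n \<and> ?H p = enc xs" for p
  proof -
    obtain xs where "length xs = n" "H (snd (prod_decode p)) = enc xs" using H(2) by blast
    then show ?thesis by (intro exI[of _ "fst (prod_decode p) # xs"]) simp
  qed
  moreover have "?H (enc xs) = enc xs" if "length xs = Suc n" for xs
    using that H(3) by (cases xs) auto
  ultimately show ?case by blast
qed

text \<open>Each formation rule of \<open>recfn\<close> matches a closure property; lists are coded
  as numbers because tables are unary.\<close>

lemma recfn_rep: "recfn n f \<Longrightarrow> \<exists>F. rep F \<and> (\<forall>xs. length xs = n \<longrightarrow> F (enc xs) = f xs)"
proof (induction rule: recfn.induct)
  case (r_zero n)
  show ?case using rep_zero by (intro exI[of _ "\<lambda>_. 0"]) simp
next
  case r_succ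
  have "Suc (fst (prod_decode (enc xs))) = Suc (hd xs)" if "length xs = 1" for xs
    using that by (cases xs) auto
  then show ?case
    using rep_comp[OF rep_succ rep_fst] by (intro exI[of _ "\<lambda>x. Suc (fst (prod_decode x))"]) simp
next
  case (r_proj i n)
  then show ?case using rep_nth[of i] by blast
next
  case (r_comp m f gs n)
  then obtain F where F: "rep F" "\<forall>xs. length xs = m \<longrightarrow> F (enc xs) = f xs" by blast
  obtain H where H: "rep H" "\<forall>xs. length xs = n \<longrightarrow> H (enc xs) = enc (map (\<lambda>g. g xs) gs)"
    using rep_map[of gs n] r_comp.IH(2) by auto
  show ?case
    using rep_comp[OF F(1) H(1)] F(2) H(2) r_comp.hyps by (intro exI[of _ "\<lambda>x. F (H x)"]) simp
next
  case (r_prim n f g)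
  then obtain F G where F: "rep F" "\<forall>xs. length xs = n \<longrightarrow> F (enc xs) = f xs"
    and G: "rep G" "\<forall>xs. length xs = Suc (Suc n) \<longrightarrow> G (enc xs) = g xs" by blast
  let ?P = "\<lambda>x. case prod_decode x of (k, p) \<Rightarrow>
    rec_nat (F p) (\<lambda>k r. G (prod_encode (k, prod_encode (r, p)))) k"
  have "?P (enc xs) = rec_nat (f (tl xs)) (\<lambda>k r. g (k # r # tl xs)) (hd xs)"
    if "length xs = Suc n" for xs
  proof -
    obtain k ys where xs: "xs = k # ys" "length ys = n" using \<open>length xs = Suc n\<close> by (cases xs) auto
    have "G (prod_encode (k, prod_encode (r, enc ys))) = g (k # r # ys)" for k r
      using G(2)[rule_format, of "k # r # ys"] xs by simp
    then show ?thesis using F(2) xs by simp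
  qed
  then show ?case using rep_prim[OF F(1) G(1)] by blast
next
  case (r_mu n f)
  then obtain F where F: "rep F" "\<forall>xs. length xs = Suc n \<longrightarrow> F (enc xs) = f xs" by blast
  have eq: "F (prod_encode (y, enc xs)) = f (y # xs)" if "length xs = n" for xs y
    using F(2)[rule_format, of "y # xs"] that by simp
  obtain H where H: "rep H" "\<And>p. \<exists>xs. length xs = n \<and> H p = enc xs"
    "\<And>xs. length xs = n \<Longrightarrow> H (enc xs) = enc xs"
    using rep_retract_enc by blast
  let ?F = "\<lambda>x. F (prod_encode (fst (prod_decode x), H (snd (prod_decode x))))"
  have "rep ?F" by (rule rep_comp[OF F(1) rep_pair[OF rep_fst rep_comp[OF H(1) rep_snd]]])
  moreover have "\<exists>y. ?F (prod_encode (y, p)) = 0" for p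
  proof -
    obtain xs where xs: "length xs = n" "H p = enc xs" using H(2) by blast
    then show ?thesis using r_mu.hyps(2) eq[OF xs(1)] by simp
  qed
  ultimately have "rep (\<lambda>p. LEAST y. ?F (prod_encode (y, p)) = 0)" by (rule rep_mu)
  moreover have "(LEAST y. ?F (prod_encode (y, enc xs)) = 0) = (LEAST y. f (y # xs) = 0)"
    if "length xs = n" for xs
    using eq[OF that] H(3)[OF that] by simp
  ultimately show ?case by (intro exI[of _ "\<lambda>p. LEAST y. ?F (prod_encode (y, p)) = 0"]) blast
qed

section \<open>Diagonalisation\<close>

text \<open>On codes a universal quantifier is three nested constructors, so a fixed prefix is a
  fixed composition of pairings.\<close>

lemma enc_form_foldr_FAll:
  assumes "rep F"
  shows "\<exists>G. rep G \<and> (\<forall>p \<phi>. F p = enc_form \<phi> \<longrightarrow> G p = enc_form (foldr FAll ys \<phi>))"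
proof (induction ys)
  case Nil
  show ?case using assms by auto
next
  case (Cons y ys)
  then obtain G where G: "rep G" "\<And>p \<phi>. F p = enc_form \<phi> \<Longrightarrow> G p = enc_form (foldr FAll ys \<phi>)"
    by blast
  let ?H = "\<lambda>p. prod_encode (5, prod_encode (7, prod_encode (y, prod_encode (5, G p))))"
  have "rep ?H" by (intro rep_pair rep_const G(1))
  moreover have "?H p = enc_form (foldr FAll (y # ys) \<phi>)" if "F p = enc_form \<phi>" for p \<phi>
    using G(2)[OF that] by (simp add: FAll_def)
  ultimately show ?case by blast
qed

lemma rep_enc_numt: "rep (\<lambda>k. enc_term (numt k))"
proof -
  \<comment> \<open>The step receives the code of \<open>(k, (r, p))\<close> and keeps
    \<open>r\<close>; tags 4 and 2 stand for \<open>TAdd\<close> and \<open>TOne\<close>.\<close>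
  let ?g = "\<lambda>x. prod_encode (4, prod_encode (prod_encode (2, 0), fst (prod_decode (snd (prod_decode x)))))"
  have "rep ?g" by (intro rep_pair rep_const rep_comp[OF rep_fst rep_snd])
  from rep_comp[OF rep_prim[OF rep_const[of "enc_term TZero"] this] rep_pair[OF rep_id rep_zero]]
  have "rep (\<lambda>k. rec_nat (enc_term TZero) (\<lambda>k r. prod_encode (4, prod_encode (prod_encode (2, 0), r))) k)"
    by simp
  moreover have "rec_nat (enc_term TZero) (\<lambda>k r. prod_encode (4, prod_encode (prod_encode (2, 0), r))) k
      = enc_term (numt k)" for k
    by (induction k) auto
  ultimately show ?thesis by simp
qed

lemma rep_enc_quad: "rep (\<lambda>k. enc_term (quad 0 (numt k)))"
  unfolding quad_def enc_term.simps by (intro rep_pair rep_const rep_enc_numt)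

text \<open>Ten variables close the formula, since \<open>specifies\<close> allows no
  others.\<close>

definition query :: "slform \<Rightarrow> nat \<Rightarrow> slform" where
  "query \<phi> n = foldr FAll [0..<10] (FAnd \<phi> (FSel (quad 0 (numt n)) TZero))"

text \<open>The substitution function of the diagonal argument: clauses receive their own code as
  the argument to look up.\<close>

lemma rep_enc_query: "\<exists>D. rep D \<and> (\<forall>\<phi>. D (enc_form \<phi>) = enc_form (query \<phi> (enc_form \<phi>)))"
proof -
  let ?F = "\<lambda>p. prod_encode (6, prod_encode (p, prod_encode (3, prod_encode
    (prod_encode (2, prod_encode (enc_term (quad 0 (numt p)), enc_term TZero)),
     enc_form (FGe TZero TZero)))))"
  have "rep ?F" by (intro rep_pair rep_const rep_enc_quad rep_id)
  from enc_form_foldr_FAll[OF this, of "[0..<10]"] obtain D where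
    D: "rep D" "\<And>p \<phi>. ?F p = enc_form \<phi> \<Longrightarrow> D p = enc_form (foldr FAll [0..<10] \<phi>)"
    by blast
  have "D (enc_form \<phi>) = enc_form (query \<phi> (enc_form \<phi>))" for \<phi>
    unfolding query_def by (rule D(2)) (simp add: FSel_def)
  with D(1) show ?thesis by blast
qed

text \<open>In a model of the query, the cell for \<open>n\<close> is allocated and can only contain
  \<open>f n\<close>; conversely, a table up to \<open>n\<close> is a model.\<close>

lemma sl_sat_query:
  assumes "specifies \<phi> f"
  shows "sl_sat (query (to_sl \<phi>) n) \<longleftrightarrow> f n = 0"
proof -
  have holds: "holds nl e h (query (to_sl \<phi>) n) \<longleftrightarrow>
      (\<forall>e. tsat nl e (h(nl := None)) \<phi>) \<and> sect 0 (h(nl := None)) (int n) = Some 0" for nl e h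
  proof -
    have "holds nl e h (query (to_sl \<phi>) n) \<longleftrightarrow>
      (\<forall>e'. (\<forall>x. x \<notin> {..<10} \<longrightarrow> e' x = e x) \<longrightarrow> tsat nl e' (h(nl := None)) \<phi> \<and>
         sect 0 (h(nl := None)) (int n) = Some 0)"
      unfolding query_def holds_foldr_FAll holds.simps(7) holds_to_sl holds_FSel
      by (simp add: sect_def atLeast0LessThan)
    also have "\<dots> \<longleftrightarrow> (\<forall>e. tsat nl e (h(nl := None)) \<phi>) \<and> sect 0 (h(nl := None)) (int n) = Some 0"
    proof -
      \<comment> \<open>Only the first ten variables occur in the clauses, so elsewhere an
        environment may be overwritten by \<open>e\<close>.\<close>
      have "tsat nl e0 (h(nl := None)) \<phi> = tsat nl (\<lambda>x. if x < 10 then e0 x else e x) (h(nl := None)) \<phi>"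
        for e0
        using specifies_tfv[OF assms] by (intro tsat_cong) auto
      then show ?thesis by (smt (verit) lessThan_iff)
    qed
    finally show ?thesis .
  qed
  show ?thesis
  proof
    assume "sl_sat (query (to_sl \<phi>) n)"
    then obtain nl h where "\<forall>e. tsat nl e (h(nl := None)) \<phi>" "sect 0 (h(nl := None)) (int n) = Some 0"
      unfolding sl_sat_def holds by blast
    then show "f n = 0"
      using agreesD specifies_agrees[OF assms] by fastforce
  next
    assume n: "f n = 0"
    \<comment> \<open>Placing \<open>nil\<close> at -1, outside the nonnegative addresses of the
      table, makes deleting its cell harmless.\<close>
    obtain h where h: "finite (dom h)" "dom h \<subseteq> {0..}"
      "\<forall>x\<le>n. sect 0 h (int x) = Some (int (f x))" "\<forall>e. tsat (-1) e h \<phi>"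
      by (rule specifies_table[OF assms])
    have "-1 \<notin> dom h" using h(2) by fastforce
    then have "h(-1 := None) = h" by (auto simp: fun_eq_iff domIff)
    then show "sl_sat (query (to_sl \<phi>) n)"
      using h n unfolding sl_sat_def holds by (intro exI[of _ "-1"] exI[of _ "\<lambda>_. 0"] exI[of _ h]) simp
  qed
qed

text \<open>The existential prefix is empty: purely universal sentences carry the reduction.\<close>

lemma in_EA_fragment_query:
  assumes "tfv \<phi> \<subseteq> {..<10}"
  shows "in_EA_fragment (query (to_sl \<phi>) n)"
proof -
  have "fvars (query (to_sl \<phi>) n) = {}"
    using assms by (auto simp: query_def fvars_foldr_FAll fvars_to_sl FSel_def)
  then show ?thesis
    unfolding in_EA_fragment_def
    by (intro exI[of _ "[]"] exI[of _ "[0..<10]"] exI[of _ "FAnd (to_sl \<phi>) (FSel (quad 0 (numt n)) TZero)"])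
      (simp add: query_def qfree_to_sl FSel_def)
qed

theorem theorem4:
  shows "\<not> (\<exists>f. recfn 1 f \<and>
            (\<forall>\<phi>. in_EA_fragment \<phi> \<longrightarrow> (f [enc_form \<phi>] = 0 \<longleftrightarrow> sl_sat \<phi>)))"
proof
  assume "\<exists>f. recfn 1 f \<and> (\<forall>\<phi>. in_EA_fragment \<phi> \<longrightarrow> (f [enc_form \<phi>] = 0 \<longleftrightarrow> sl_sat \<phi>))"
  then obtain f where "recfn 1 f"
    and f: "\<And>\<phi>. in_EA_fragment \<phi> \<Longrightarrow> f [enc_form \<phi>] = 0 \<longleftrightarrow> sl_sat \<phi>" by blast
  then obtain F where "rep F" and "\<forall>xs. length xs = 1 \<longrightarrow> F (enc xs) = f xs"
    using recfn_rep by blast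
  then have F: "rep F" "F (prod_encode (x, 0)) = f [x]" for x
    by (simp, metis One_nat_def enc.simps length_Cons list.size(3))
  obtain D where D: "rep D" "\<And>\<phi>. D (enc_form \<phi>) = enc_form (query \<phi> (enc_form \<phi>))"
    using rep_enc_query by blast
  \<comment> \<open>If \<open>p\<close> codes a formula, the tested value is the verdict of
    \<open>f\<close> on the query of that formula at \<open>p\<close>.\<close>
  define g where "g p = (if F (prod_encode (D p, 0)) = 0 then 1 else 0 :: nat)" for p
  have "rep g"
    unfolding g_def by (rule rep_comp[OF rep_is_zero rep_comp[OF F(1) rep_pair[OF D(1) rep_zero]]])
  then obtain \<phi> where \<phi>: "specifies \<phi> g" by (auto simp: rep_def)
  \<comment> \<open>For this \<open>p\<close>, \<open>D p\<close> codes the very query whose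
    satisfiability amounts to \<open>g p = 0\<close>.\<close>
  define p where "p = enc_form (to_sl \<phi>)"
  let ?\<psi> = "query (to_sl \<phi>) p"
  have "f [enc_form ?\<psi>] = 0 \<longleftrightarrow> g p = 0"
    using f[OF in_EA_fragment_query[OF specifies_tfv[OF \<phi>]]] sl_sat_query[OF \<phi>] by blast
  moreover have "g p = 0 \<longleftrightarrow> f [enc_form ?\<psi>] \<noteq> 0"
    by (simp add: g_def F(2) D(2) p_def)
  ultimately show False by (cases "g p = 0") simp_all
qed

end
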